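(* Assume $2^{\omega_1}>\omega_2$ and $\mathsf{CH}$. Then there are $2^{\mathfrak c}$ many pairwise incomparable Tukey classes represented by tower ideals, i.e. by directed sets of the form $(\langle\mathcal T\rangle,\subseteq)$ where $\mathcal T$ is a tower of length $\omega_1$.
   Context: A tower of length $\omega_1$ is a family $\mathcal T=(T_\alpha)_{\alpha<\omega_1}$ of subsets of $\omega$ such that, for all $\alpha,\beta<\omega_1$, $T_\alpha\setminus T_\beta$ is finite if and only if $\alpha\le\beta$ (no maximality is assumed). $\langle\mathcal T\rangle$ denotes the ideal on $\omega$ generated by $\mathcal T$ and all finite subsets of $\omega$, ordered by $\subseteq$. For directed sets $\mathcal D,\mathcal E$, a function $g\colon\mathcal D\to\mathcal E$ is Tukey if the image of every unbounded subset of $\mathcal D$ is unbounded in $\mathcal E$; $\mathcal D\le_T\mathcal E$ means that such a $g$ exists; $\mathcal D\equiv\mathcal E$ (Tukey equivalent) means $\mathcal D\le_T\mathcal E$ and $\mathcal E\le_T\mathcal D$. Tukey classes are the equivalence classes of $\equiv$; two classes are incomparable if neither is $\le_T$ the other. $\mathfrak c=2^{\aleph_0}$. *)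

theory Defs
  imports Complex_Main
begin

unbundle cardinal_syntax

section \<open>Cardinals\<close>

text \<open>
  The well-order \<open>omega1\<close> serves both as the cardinal \<open>\<aleph>\<^sub>1\<close> and as the ordinal \<open>\<omega>\<^sub>1\<close>: its field is
  the index set of the countable ordinals, and \<open>(\<alpha>, \<beta>) \<in> omega1\<close> reads \<open>\<alpha> \<le> \<beta>\<close>.
\<close>

definition omega1 :: "nat set rel" where
  "omega1 = cardSuc natLeq"

definition omega2 :: "nat set set rel" where
  "omega2 = cardSuc omega1"

definition continuum :: "(nat \<Rightarrow> bool) rel" where
  "continuum = ctwo ^c natLeq"

section \<open>Towers and their ideals\<close>

definition tower :: "(nat set \<Rightarrow> nat set) \<Rightarrow> bool" where
  "tower T \<longleftrightarrow>
     (\<forall>\<alpha>\<in>Field omega1. \<forall>\<beta>\<in>Field omega1. finite (T \<alpha> - T \<beta>) \<longleftrightarrow> (\<alpha>, \<beta>) \<in> omega1)"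

text \<open>
  Ideals are not required to be proper. No set of a tower's ideal is cofinite, so restricting the hull
  below to proper ideals would not change it.
\<close>

definition set_ideal :: "'a set set \<Rightarrow> bool" where
  "set_ideal I \<longleftrightarrow>
     {} \<in> I \<and> (\<forall>A\<in>I. \<forall>B. B \<subseteq> A \<longrightarrow> B \<in> I) \<and> (\<forall>A\<in>I. \<forall>B\<in>I. A \<union> B \<in> I)"

definition tower_ideal :: "(nat set \<Rightarrow> nat set) \<Rightarrow> nat set set" where
  "tower_ideal T = set_ideal hull (T ` Field omega1 \<union> {F. finite F})"

section \<open>Tukey reducibility\<close>

text \<open>
  A directed set is represented by its (reflexive) order relation; the underlying set is the field of
  that relation.
\<close>

definition directed_set :: "'a rel \<Rightarrow> bool" where
  "directed_set D \<longleftrightarrow> Preorder D \<and> Field D \<noteq> {} \<and>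
     (\<forall>x\<in>Field D. \<forall>y\<in>Field D. \<exists>z. (x, z) \<in> D \<and> (y, z) \<in> D)"

definition unbounded_in :: "'a rel \<Rightarrow> 'a set \<Rightarrow> bool" where
  "unbounded_in D X \<longleftrightarrow> X \<subseteq> Field D \<and> \<not> (\<exists>b\<in>Field D. \<forall>x\<in>X. (x, b) \<in> D)"

definition tukey_map :: "'a rel \<Rightarrow> 'b rel \<Rightarrow> ('a \<Rightarrow> 'b) \<Rightarrow> bool" where
  "tukey_map D E g \<longleftrightarrow> g ` Field D \<subseteq> Field E \<and>
     (\<forall>X. unbounded_in D X \<longrightarrow> unbounded_in E (g ` X))"

definition tukey_le :: "'a rel \<Rightarrow> 'b rel \<Rightarrow> bool" where
  "tukey_le D E \<longleftrightarrow> (\<exists>g. tukey_map D E g)"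

definition tukey_equiv :: "'a rel \<Rightarrow> 'b rel \<Rightarrow> bool" where
  "tukey_equiv D E \<longleftrightarrow> tukey_le D E \<and> tukey_le E D"

text \<open>
  Tukey classes over all directed sets would be proper classes; here they are the equivalence classes
  among the directed sets whose elements have the given type \<open>'a\<close>.
\<close>

definition tukey_equiv_rel :: "'a rel rel" where
  "tukey_equiv_rel = {(D, E). directed_set D \<and> directed_set E \<and> tukey_equiv D E}"

definition tukey_classes :: "'a rel set set" where
  "tukey_classes = Collect directed_set // tukey_equiv_rel"

definition tukey_class_le :: "'a rel set \<Rightarrow> 'a rel set \<Rightarrow> bool" where
  "tukey_class_le C C' \<longleftrightarrow> (\<exists>D\<in>C. \<exists>E\<in>C'. tukey_le D E)"

definition tukey_incomparable :: "'a rel set \<Rightarrow> 'a rel set \<Rightarrow> bool" where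
  "tukey_incomparable C C' \<longleftrightarrow> \<not> tukey_class_le C C' \<and> \<not> tukey_class_le C' C"

lemma tukey_le_refl: "tukey_le D D"
  unfolding tukey_le_def tukey_map_def by (rule exI[of _ id]) simp

lemma tukey_le_trans:
  assumes "tukey_le D E" and "tukey_le E F"
  shows "tukey_le D F"
proof -
  obtain g h where g: "tukey_map D E g" and h: "tukey_map E F h"
    using assms unfolding tukey_le_def by blast
  have "tukey_map D F (h \<circ> g)"
    using g h unfolding tukey_map_def image_comp[symmetric] by blast
  then show ?thesis unfolding tukey_le_def by blast
qed

lemma equiv_tukey_equiv_rel: "equiv (Collect directed_set) tukey_equiv_rel"
  unfolding equiv_def refl_on_def sym_def trans_def tukey_equiv_rel_def tukey_equiv_def
  using tukey_le_refl tukey_le_trans by blast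

lemma tukey_class_le_iff:
  assumes "C \<in> tukey_classes" "C' \<in> tukey_classes" "D \<in> C" "E \<in> C'"
  shows "tukey_class_le C C' \<longleftrightarrow> tukey_le D E"
proof -
  have eq: "tukey_le A B" if "K \<in> tukey_classes" "A \<in> K" "B \<in> K" for K and A B :: "'a rel"
    using quotient_eq_iff[OF equiv_tukey_equiv_rel, of K K A B] that
    unfolding tukey_classes_def by (auto simp: tukey_equiv_rel_def tukey_equiv_def)
  show ?thesis
    unfolding tukey_class_le_def using assms eq tukey_le_trans by meson
qed

lemma directed_set_tower_ideal: "directed_set (relation_of (\<subseteq>) (tower_ideal T))"
proof -
  have I: "set_ideal (tower_ideal T)"
    unfolding tower_ideal_def by (rule hull_in) (auto simp: set_ideal_def)
  have F: "Field (relation_of (\<subseteq>) (tower_ideal T)) = tower_ideal T"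
    by (auto simp: Field_def relation_of_def)
  have U: "\<exists>z\<in>tower_ideal T. x \<subseteq> z \<and> y \<subseteq> z" if "x \<in> tower_ideal T" "y \<in> tower_ideal T" for x y
    using I that unfolding set_ideal_def by (meson Un_upper1 Un_upper2)
  have "{} \<in> tower_ideal T"
    using I unfolding set_ideal_def by blast
  then show ?thesis
    unfolding directed_set_def F using U
    by (fastforce simp: relation_of_def preorder_on_def refl_on_def trans_def)
qed

end

theory Submission
  imports Defs "HOL-Library.Disjoint_Sets" "HOL-Library.Infinite_Set" "HOL-Library.Nat_Bijection"
begin

text \<open>
  The set of reals that code Tukey reductions has size continuum, so a suitable ideal has few Tukey
  predecessors; a general theorem about set mappings then produces a large incomparable family.

  Tower ideals are directed modulo finite sets under countable subsets. If such an ideal \<open>E\<close> is also non-meager,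
  then every Tukey reduction of an ideal \<open>D\<close> on \<open>\<omega>\<close> to \<open>E\<close> is witnessed by a monotone cofinal map from \<open>E\<close> to
  \<open>D\<close> that is continuous on a cofinal part of \<open>E\<close>, and therefore \<open>D\<close> is determined by \<open>E\<close> and one real
  (\<open>tukey_below_decoded\<close>). This is the argument that Dobrinen and Todorcevic use for p-points. Under CH such
  an \<open>E\<close> has at most \<open>\<omega>\<^sub>1\<close> Tukey predecessors among the ideals on \<open>\<omega>\<close>.

  Under CH there are also only \<open>\<omega>\<^sub>1\<close> many growth functions \<open>\<phi>\<close> to be treated in order to make the ideal of a
  tower non-meager, and one of them can be treated at each stage of a construction of length \<open>\<omega>\<^sub>1\<close>. Every
  stage leaves room for a binary decision with incompatible outcomes, which yields distinct ideals for distinct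
  subsets of \<open>\<omega>\<^sub>1\<close> (\<open>branch_ideal_captures_tails\<close>, \<open>inj_branch_ideal\<close>).

  Thus \<open>2^\<omega>\<^sub>1\<close> many ideals carry a relation in which each is above at most \<open>\<omega>\<^sub>1\<close> others. As
  their number exceeds \<open>\<omega>\<^sub>2\<close>, Hajnal's free set theorem (\<open>free_set_theorem\<close>) yields equally many that are
  pairwise incomparable, and under CH that number is two to the continuum.
\<close>

section \<open>Free sets for set mappings\<close>

definition free_set :: "('a \<Rightarrow> 'a set) \<Rightarrow> 'a set \<Rightarrow> bool" where
  "free_set f F \<longleftrightarrow> (\<forall>x\<in>F. \<forall>y\<in>F. x \<noteq> y \<longrightarrow> y \<notin> f x)"

lemma wf_Card_order: "Card_order r \<Longrightarrow> wf (r - Id)"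
  by (simp add: card_order_on_def well_order_on_def)

lemma regular_bounded:
  assumes "Cinfinite n" "regularCard n" "H \<subseteq> Field n" "|H| <o n"
  shows "\<exists>b\<in>Field n. \<forall>h\<in>H. (h, b) \<in> n \<and> h \<noteq> b"
proof -
  have W: "wo_rel n"
    using assms(1) by (simp add: card_order_on_def wo_rel_def)
  have "\<not> cofinal H n"
    using assms unfolding regularCard_def using not_ordLess_ordIso by blast
  then obtain a where a: "a \<in> Field n" "\<forall>h\<in>H. h = a \<or> (a, h) \<notin> n"
    unfolding cofinal_def by metis
  obtain b where b: "b \<in> Field n" "a \<noteq> b" "(a, b) \<in> n"
    using infinite_Card_order_limit[of n a] assms(1) a(1) by (auto simp: cinfinite_def)
  have "(h, b) \<in> n \<and> h \<noteq> b" if "h \<in> H" for h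
  proof -
    have "(h, a) \<in> n"
      using a that assms(3) wo_rel.TOTALS[OF W] by (metis subsetD)
    then show ?thesis
      using b wo_rel.TRANS[OF W] wo_rel.ANTISYM[OF W] unfolding trans_def antisym_def by blast
  qed
  then show ?thesis using b by blast
qed

lemma regular_pigeonhole:
  assumes k: "Cinfinite k" "regularCard k" and "|I| <o k" and "|\<Union>i\<in>I. A i| =o k"
    and "\<And>i. i \<in> I \<Longrightarrow> A i \<subseteq> B" "|B| =o k"
  shows "\<exists>i\<in>I. |A i| =o k"
proof (rule ccontr)
  assume "\<not> ?thesis"
  moreover have "|A i| \<le>o k" if "i \<in> I" for i
    using assms(5)[OF that] assms(6) card_of_mono1 ordLeq_ordIso_trans by blast
  ultimately have "\<forall>i\<in>I. |A i| <o k"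
    using ordLeq_iff_ordLess_or_ordIso by blast
  then have "|\<Union>i\<in>I. A i| <o k"
    using card_of_UNION_ordLess_infinite_Field_regularCard k assms(3) by blast
  then show False using assms(4) not_ordLess_ordIso by blast
qed

lemma split_into_pieces:
  assumes "Cinfinite l" "|S| =o l" "Card_order n" "n \<le>o l" "Field n \<noteq> {}"
  shows "\<exists>P. (\<forall>i\<in>Field n. P i \<subseteq> S \<and> |P i| =o l) \<and> disjoint_family_on P (Field n)"
proof -
  have inf: "infinite S"
    using assms(1) card_of_ordIso_finite_Field[OF _ ordIso_symmetric[OF assms(2)]]
    by (auto simp: cinfinite_def)
  have "|Field n| \<le>o |S|"
    using assms card_of_Field_ordIso ordIso_ordLeq_trans ordIso_symmetric ordLeq_ordIso_trans by blast
  then have "|Field n \<times> S| =o |S|"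
    using card_of_Times_infinite[OF inf assms(5)] by blast
  then obtain h where h: "bij_betw h (Field n \<times> S) S"
    using card_of_ordIso by blast
  define P where "P i = h ` ({i} \<times> S)" for i
  have "|P i| =o l" if "i \<in> Field n" for i
  proof -
    have "inj_on (\<lambda>x. h (i, x)) S"
      using h that unfolding bij_betw_def inj_on_def by blast
    moreover have "P i = (\<lambda>x. h (i, x)) ` S" unfolding P_def by auto
    ultimately have "bij_betw (\<lambda>x. h (i, x)) S (P i)" by (simp add: bij_betw_def)
    then have "|S| =o |P i|" using card_of_ordIso by blast
    then show ?thesis using assms(2) ordIso_symmetric ordIso_transitive by blast
  qed
  moreover have "P i \<subseteq> S" if "i \<in> Field n" for i
    using h that unfolding P_def bij_betw_def by blast
  moreover have "disjoint_family_on P (Field n)"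
    using h unfolding P_def bij_betw_def inj_on_def disjoint_family_on_def by blast
  ultimately show ?thesis by blast
qed

lemma ex_maximal_free:
  "\<exists>F. F \<subseteq> S \<and> free_set f F \<and> (\<forall>x\<in>S - F. \<not> free_set f (insert x F))"
proof -
  let ?A = "{F. F \<subseteq> S \<and> free_set f F}"
  have "\<exists>U\<in>?A. \<forall>X\<in>\<C>. X \<subseteq> U" if "subset.chain ?A \<C>" for \<C>
  proof (intro bexI ballI)
    have c: "\<C> \<subseteq> ?A" "\<And>X Y. X \<in> \<C> \<Longrightarrow> Y \<in> \<C> \<Longrightarrow> X \<subseteq> Y \<or> Y \<subseteq> X"
      using that unfolding subset_chain_def by auto
    have "y \<notin> f x" if xy: "X \<in> \<C>" "Y \<in> \<C>" "x \<in> X" "y \<in> Y" "x \<noteq> y" for X Y x y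
    proof -
      have "\<exists>Z\<in>\<C>. x \<in> Z \<and> y \<in> Z" using c(2)[OF xy(1,2)] xy by blast
      then show ?thesis using c(1) xy(5) unfolding free_set_def by blast
    qed
    then show "\<Union>\<C> \<in> ?A" using c(1) unfolding free_set_def by blast
  qed auto
  then obtain M where M: "M \<in> ?A" "\<forall>X\<in>?A. M \<subseteq> X \<longrightarrow> X = M"
    using subset_Zorn[of ?A] by blast
  have "\<not> free_set f (insert x M)" if "x \<in> S - M" for x
  proof
    assume "free_set f (insert x M)"
    then have "insert x M \<in> ?A" using M(1) that by simp
    then have "insert x M = M" using M(2) by blast
    then show False using that by blast
  qed
  then show ?thesis using M by auto
qed

text \<open>
  If every free subset of \<open>K\<close> is smaller than the regular cardinal \<open>k\<close>, then a sequence of \<open>cardSuc r\<close>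
  disjoint sets, each a maximal free subset of what the earlier ones leave over, together with all values
  of \<open>f\<close> on them, still misses some \<open>x\<close> in \<open>K\<close>. By maximality \<open>x\<close> is in conflict with a member of each of
  these sets, and as \<open>x\<close> lies in none of the values of \<open>f\<close> there, that member lies in \<open>f x\<close>. So \<open>f x\<close> has
  \<open>cardSuc r\<close> elements, which is too many.
\<close>

lemma free_set_regular:
  fixes f :: "'a \<Rightarrow> 'a set" and k :: "'k rel" and r :: "'r rel"
  assumes r: "Cinfinite r" and k: "Cinfinite k" "regularCard k" and rk: "cardSuc r <o k"
    and K: "|K| =o k" and f: "\<And>x. x \<in> K \<Longrightarrow> |f x| \<le>o r"
  shows "\<exists>F\<subseteq>K. free_set f F \<and> |F| =o k"
proof (rule ccontr)
  assume no: "\<not> ?thesis"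
  have small: "|F| <o k" if "F \<subseteq> K" "free_set f F" for F
  proof -
    have "|F| \<le>o k"
      using that K card_of_mono1 ordLeq_ordIso_trans by blast
    then show ?thesis using no that ordLeq_iff_ordLess_or_ordIso by blast
  qed
  let ?s = "cardSuc r"
  have s: "Cinfinite ?s" using r Cinfinite_cardSuc by blast
  have "\<exists>A. \<forall>i. A i \<subseteq> K - \<Union>(A ` underS ?s i) \<and> free_set f (A i) \<and>
     (\<forall>x\<in>K - \<Union>(A ` underS ?s i) - A i. \<not> free_set f (insert x (A i)))"
  proof (rule dependent_wf_choice[OF wf_Card_order, of ?s "\<lambda>A i F.
       F \<subseteq> K - \<Union>(A ` underS ?s i) \<and> free_set f F \<and>
       (\<forall>x\<in>K - \<Union>(A ` underS ?s i) - F. \<not> free_set f (insert x F))"])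
    show "Card_order ?s" using s by blast
  next
    fix g h :: "'r set \<Rightarrow> 'a set" and x F
    assume "\<And>z. (z, x) \<in> ?s - Id \<Longrightarrow> g z = h z"
    then have "g ` underS ?s x = h ` underS ?s x"
      by (intro image_cong) (auto simp: underS_def)
    then show "(F \<subseteq> K - \<Union>(g ` underS ?s x) \<and> free_set f F \<and>
       (\<forall>y\<in>K - \<Union>(g ` underS ?s x) - F. \<not> free_set f (insert y F))) \<longleftrightarrow>
       (F \<subseteq> K - \<Union>(h ` underS ?s x) \<and> free_set f F \<and>
       (\<forall>y\<in>K - \<Union>(h ` underS ?s x) - F. \<not> free_set f (insert y F)))"
      by simp
  next
    fix x and g :: "'r set \<Rightarrow> 'a set"
    show "\<exists>F. F \<subseteq> K - \<Union>(g ` underS ?s x) \<and> free_set f F \<and>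
       (\<forall>y\<in>K - \<Union>(g ` underS ?s x) - F. \<not> free_set f (insert y F))"
      by (rule ex_maximal_free)
  qed
  then obtain A where A0: "\<forall>i. A i \<subseteq> K - \<Union>(A ` underS ?s i) \<and> free_set f (A i) \<and>
     (\<forall>x\<in>K - \<Union>(A ` underS ?s i) - A i. \<not> free_set f (insert x (A i)))"
    by (elim exE)
  have A: "\<And>i. A i \<subseteq> K - \<Union>(A ` underS ?s i)" "\<And>i. free_set f (A i)"
    "\<And>i x. x \<in> K - \<Union>(A ` underS ?s i) - A i \<Longrightarrow> \<not> free_set f (insert x (A i))"
    using A0 by (metis+)
  define Y where "Y = (\<Union>i\<in>Field ?s. A i)"
  have sF: "|Field ?s| <o k"
    using s rk card_of_Field_ordIso ordIso_ordLess_trans by blast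
  have AK: "A i \<subseteq> K" for i using A(1)[of i] by blast
  have Y: "|Y| <o k"
    unfolding Y_def
    using card_of_UNION_ordLess_infinite_Field_regularCard[OF k(2,1) sF] small AK A(2) by blast
  have YK: "Y \<subseteq> K" unfolding Y_def using AK by blast
  have "r <o k"
    using cardSuc_greater r rk ordLess_transitive by blast
  then have "|f y| <o k" if "y \<in> Y" for y
    using f YK that ordLeq_ordLess_trans by blast
  then have "|\<Union>y\<in>Y. f y| <o k"
    using card_of_UNION_ordLess_infinite_Field_regularCard[OF k(2,1) Y] by blast
  then have "|Y \<union> (\<Union>y\<in>Y. f y)| <o k"
    using Y k(1) Un_Cinfinite_bound_strict by blast
  then have "|Y \<union> (\<Union>y\<in>Y. f y)| <o |K|"
    using K ordIso_symmetric ordLess_ordIso_trans by blast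
  then have "\<not> K \<subseteq> Y \<union> (\<Union>y\<in>Y. f y)"
    using card_of_mono1 not_ordLess_ordLeq by blast
  then obtain x where x: "x \<in> K" "x \<notin> Y" "\<And>y. y \<in> Y \<Longrightarrow> x \<notin> f y" by blast
  \<comment> \<open>maximality of \<open>A i\<close> applies to \<open>x\<close>, because \<open>x\<close> avoids all earlier sets as well\<close>
  have "\<exists>a\<in>A i. a \<in> f x" if i: "i \<in> Field ?s" for i
  proof -
    have "underS ?s i \<subseteq> Field ?s" using underS_Field by fastforce
    then have "x \<in> K - \<Union>(A ` underS ?s i) - A i"
      using x(1,2) i unfolding Y_def by blast
    then have "\<not> free_set f (insert x (A i))" using A(3) by blast
    then show ?thesis
      using A(2)[of i] x(3) i unfolding free_set_def Y_def by blast
  qed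
  then obtain a where a: "\<And>i. i \<in> Field ?s \<Longrightarrow> a i \<in> A i \<and> a i \<in> f x" by metis
  have W: "wo_rel ?s" using s by (simp add: card_order_on_def wo_rel_def)
  have dis: "a i \<noteq> a j" if "i \<in> Field ?s" "j \<in> Field ?s" "i \<noteq> j" "(i, j) \<in> ?s" for i j
  proof
    assume "a i = a j"
    moreover have "i \<in> underS ?s j" using that unfolding underS_def by blast
    ultimately show False using A(1)[of j] a[OF that(1)] a[OF that(2)] by auto
  qed
  have "inj_on a (Field ?s)"
    using dis wo_rel.TOTALS[OF W] unfolding inj_on_def by metis
  then have "|Field ?s| \<le>o |f x|"
    using a card_of_ordLeq[of "Field ?s" "f x"] by blast
  then have "?s \<le>o r"
    using f[OF x(1)] s card_of_Field_ordIso ordIso_symmetric ordIso_ordLeq_trans ordLeq_transitive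
    by metis
  then show False using cardSuc_greater r not_ordLess_ordLeq by blast
qed

text \<open>
  The inductive step for singular \<open>|K|\<close>. Think of \<open>G j\<close> as the elements of colour \<open>j\<close> chosen so far. The set
  \<open>f x\<close> meets at most \<open>r\<close> of the disjoint classes \<open>G j\<close>, so the colours that it meets are bounded in the
  regular cardinal \<open>n\<close>; as \<open>n < l\<close>, the same bound \<open>b\<close> serves for \<open>l\<close> many elements of the new block \<open>D\<close>.
  These elements are then distributed evenly over the colours.
\<close>

lemma coloured_block_exists:
  fixes f :: "'a \<Rightarrow> 'a set" and G :: "'n \<Rightarrow> 'a set" and n :: "'n rel" and r :: "'r rel"
  assumes n: "Cinfinite n" "regularCard n" and l: "Cinfinite l" "regularCard l"
    and rn: "r <o n" and nl: "n <o l" and D: "|D| =o l" and f: "\<And>x. x \<in> D \<Longrightarrow> |f x| \<le>o r"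
    and G: "disjoint_family_on G (Field n)"
  shows "\<exists>P. \<exists>b\<in>Field n. (\<forall>i\<in>Field n. P i \<subseteq> D \<and> |P i| =o l) \<and> disjoint_family_on P (Field n) \<and>
     (\<forall>i\<in>Field n. \<forall>j\<in>Field n. (b, j) \<in> n \<longrightarrow> (\<forall>x\<in>P i. f x \<inter> G j = {}))"
proof -
  have W: "wo_rel n"
    using n(1) by (simp add: card_order_on_def wo_rel_def)
  have ne: "Field n \<noteq> {}"
    using n(1) by (auto simp: cinfinite_def)
  have "\<exists>b\<in>Field n. \<forall>j\<in>Field n. (b, j) \<in> n \<longrightarrow> f x \<inter> G j = {}" if x: "x \<in> D" for x
  proof -
    define H where "H = {j \<in> Field n. f x \<inter> G j \<noteq> {}}"
    \<comment> \<open>\<open>H\<close> injects into \<open>f x\<close>, because the classes are disjoint\<close>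
    define g where "g j = (SOME y. y \<in> f x \<inter> G j)" for j
    have g: "g j \<in> f x \<inter> G j" if "j \<in> H" for j
      using that unfolding g_def H_def some_in_eq by blast
    have "inj_on g H"
    proof (rule inj_onI)
      fix i j assume ij: "i \<in> H" "j \<in> H" "g i = g j"
      then have "g i \<in> G i \<inter> G j" using g by fastforce
      then show "i = j" using G ij(1,2) unfolding disjoint_family_on_def H_def by blast
    qed
    then have "|H| \<le>o |f x|" using g card_of_ordLeq[of H "f x"] by blast
    then have "|H| <o n" using f[OF x] rn ordLeq_transitive ordLeq_ordLess_trans by blast
    then obtain b where "b \<in> Field n" "\<forall>h\<in>H. (h, b) \<in> n \<and> h \<noteq> b"
      using regular_bounded[OF n, of H] unfolding H_def by blast
    moreover from this have "f x \<inter> G j = {}" if "j \<in> Field n" "(b, j) \<in> n" for j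
      using that wo_rel.ANTISYM[OF W] unfolding H_def antisym_def by blast
    ultimately show ?thesis by blast
  qed
  then obtain t where t: "\<And>x. x \<in> D \<Longrightarrow> t x \<in> Field n"
    "\<And>x j. x \<in> D \<Longrightarrow> j \<in> Field n \<Longrightarrow> (t x, j) \<in> n \<Longrightarrow> f x \<inter> G j = {}" by metis
  have "D = (\<Union>b\<in>Field n. {x \<in> D. t x = b})" using t(1) by blast
  then have "|\<Union>b\<in>Field n. {x \<in> D. t x = b}| =o l" using D by simp
  moreover have "|Field n| <o l"
    using n nl card_of_Field_ordIso ordIso_ordLess_trans by blast
  ultimately obtain b where b: "b \<in> Field n" "|{x \<in> D. t x = b}| =o l"
    using regular_pigeonhole[OF l, of "Field n" "\<lambda>b. {x \<in> D. t x = b}" D] D by blast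
  obtain P where "(\<forall>i\<in>Field n. P i \<subseteq> {x \<in> D. t x = b} \<and> |P i| =o l) \<and> disjoint_family_on P (Field n)"
    using split_into_pieces[OF l(1) b(2) conjunct2[OF n(1)] ordLess_imp_ordLeq[OF nl] ne]
    by (elim exE)
  then have P: "\<And>i. i \<in> Field n \<Longrightarrow> P i \<subseteq> {x \<in> D. t x = b} \<and> |P i| =o l"
    "disjoint_family_on P (Field n)" by simp_all
  show ?thesis
  proof (intro exI[of _ P] bexI[OF _ b(1)] conjI ballI impI)
    show "P i \<subseteq> D" "|P i| =o l" if "i \<in> Field n" for i using P(1)[OF that] by auto
    show "disjoint_family_on P (Field n)" by (rule P(2))
    show "f x \<inter> G j = {}" if "i \<in> Field n" "j \<in> Field n" "(b, j) \<in> n" "x \<in> P i" for i j x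
      using P(1)[OF that(1)] that t(2) by blast
  qed
qed

text \<open>
  Blocks \<open>D c\<close> are indexed by a set \<open>C'\<close> of fewer than \<open>|K|\<close> points of \<open>K\<close>. Their sizes \<open>l c\<close> are regular,
  increase strictly with \<open>c\<close>, have supremum \<open>|K|\<close>, and lie above a regular cardinal \<open>n\<close> that is larger than both
  \<open>|C'|\<close> and \<open>r\<close>. Removing from a block the values of \<open>f\<close> on earlier blocks removes less than its full size, and
  what is left contains a free set of full size by the regular case. It remains to control the values of \<open>f\<close>
  that point back to earlier blocks.

  Selecting one free set per block by transfinite recursion fails, since a late block of size \<open>l c\<close> may hit
  everything that was selected in an early one. Therefore \<open>n\<close> candidates (colours) are kept alive in every
  block. Each block rules out only the colours below some bound in \<open>n\<close>, there are fewer than \<open>n\<close> blocks, and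
  so one colour survives everywhere. The union of the sets of this colour is the free set.
\<close>

lemma free_set_singular:
  fixes f :: "'a \<Rightarrow> 'a set" and r :: "'r rel"
  assumes r: "Cinfinite r" and K: "infinite K" "\<not> regularCard |K|" and rK: "r <o |K|"
    and f: "\<And>x. x \<in> K \<Longrightarrow> |f x| \<le>o r"
  shows "\<exists>F\<subseteq>K. free_set f F \<and> |F| =o |K|"
proof -
  define k where "k = |K|"
  have k: "Cinfinite k" and Fk: "Field k = K"
    using K(1) card_of_Card_order[of K] unfolding k_def by (simp_all add: cinfinite_def Field_card_of)
  have W: "wo_rel k"
    using k by (simp add: card_order_on_def wo_rel_def)
  obtain C where C: "C \<subseteq> K" "cofinal C k" "\<not> |C| =o k"
    using K(2) Fk unfolding regularCard_def k_def by blast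
  have Ck: "|C| <o k"
    using C(1,3) card_of_mono1 ordLeq_iff_ordLess_or_ordIso unfolding k_def by blast
  define q where "q = |C| +c r"
  have q: "Cinfinite q"
    unfolding q_def using r by (simp add: Cinfinite_csum)
  have Plus_less: "|A <+> B| <o k" if "|A| <o k" "|B| <o k" for A :: "'x set" and B :: "'y set"
    using card_of_Plus_ordLess_infinite[OF K(1)] that unfolding k_def by blast
  have Field_less: "|Field p| <o k" if "Card_order p" "p <o k" for p :: "'p rel"
    using that card_of_Field_ordIso ordIso_ordLess_trans by blast
  have "|Field |C| | <o k" using Ck by (simp only: Field_card_of)
  moreover have "|Field r| <o k" using Field_less r rK unfolding k_def by blast
  ultimately have "q <o k" unfolding q_def csum_def by (intro Plus_less)
  define n where "n = cardSuc q"
  have n: "Cinfinite n" "regularCard n"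
    unfolding n_def using q Cinfinite_cardSuc regularCard_cardSuc by blast+
  \<comment> \<open>a successor cardinal is regular, so it cannot be \<open>|K|\<close>\<close>
  have succ_less: "cardSuc p <o k" if "Cinfinite p" "p <o k" for p :: "'p rel"
  proof -
    have "cardSuc p \<le>o k" using that k cardSuc_least by blast
    moreover have "\<not> cardSuc p =o k"
      using regularCard_ordIso[OF _ Cinfinite_cardSuc[OF that(1)] regularCard_cardSuc[OF that(1)]]
        K(2) unfolding k_def by blast
    ultimately show ?thesis using ordLeq_iff_ordLess_or_ordIso by blast
  qed
  have nk: "n <o k" unfolding n_def using succ_less q \<open>q <o k\<close> by blast
  have Cq: "|C| \<le>o q" unfolding q_def using ordLeq_csum1 card_of_Card_order by blast
  have rq: "r \<le>o q" unfolding q_def using ordLeq_csum2 r by blast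
  have qn: "q <o n" unfolding n_def using cardSuc_greater q by blast
  have Cn: "|C| <o n" and rn: "r <o n"
    using Cq rq qn ordLeq_ordLess_trans by blast+
  define m where "m c = n +c |underS k c|" for c
  have m: "Cinfinite (m c)" for c
    unfolding m_def using n(1) by (simp add: Cinfinite_csum)
  have nm: "n \<le>o m c" for c
    unfolding m_def using ordLeq_csum1 n by blast
  have um: "|underS k c| \<le>o m c" for c
    unfolding m_def using ordLeq_csum2 card_of_Card_order by blast
  have Cm: "|C| \<le>o m c" and rm: "r \<le>o m c" for c
    using ordLeq_transitive[OF ordLess_imp_ordLeq[OF Cn] nm]
      ordLeq_transitive[OF ordLess_imp_ordLeq[OF rn] nm] by this
  have mk: "m c <o k" if "c \<in> K" for c
  proof -
    have "|underS k c| <o k"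
      by (rule card_of_underS) (use k that Fk in simp_all)
    then have "|Field |underS k c| | <o k" by (simp only: Field_card_of)
    moreover have "|Field n| <o k" using Field_less nk n(1) by blast
    ultimately show ?thesis unfolding m_def csum_def by (intro Plus_less)
  qed
  define l where "l c = cardSuc (m c)" for c
  have l: "Cinfinite (l c)" "regularCard (l c)" and ml: "m c <o l c" for c
    unfolding l_def using m Cinfinite_cardSuc regularCard_cardSuc cardSuc_greater by blast+
  have lk: "l c <o k" if "c \<in> K" for c
    unfolding l_def using that mk m succ_less by blast
  \<comment> \<open>one index for each cardinality \<open>m c\<close>, so that block sizes increase strictly along \<open>C'\<close>\<close>
  define C' where "C' = {c \<in> C. \<forall>c'\<in>C. (c', c) \<in> k \<and> c' \<noteq> c \<longrightarrow> m c' <o m c}"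
  have C'C: "C' \<subseteq> C" and C'K: "C' \<subseteq> K" unfolding C'_def using C(1) by auto
  have C': "\<exists>c'\<in>C'. m c \<le>o m c'" if "c \<in> C" for c
  proof -
    let ?Z = "{c' \<in> C. m c \<le>o m c'}"
    have "c \<in> ?Z" using that m ordLeq_refl by blast
    then obtain z where z: "z \<in> ?Z" "\<And>y. (y, z) \<in> k - Id \<Longrightarrow> y \<notin> ?Z"
      using wfE_min[OF wf_Card_order[of k], of c ?Z] k by blast
    have "m y <o m z" if y: "y \<in> C" "(y, z) \<in> k" "y \<noteq> z" for y
    proof -
      have "\<not> m c \<le>o m y" using z(2) y by blast
      then have "m y <o m c"
        using m card_order_on_well_order_on not_ordLeq_iff_ordLess by metis
      then show ?thesis using z(1) ordLess_ordLeq_trans by blast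
    qed
    then have "z \<in> C'" using z(1) unfolding C'_def by blast
    then show ?thesis using z(1) by blast
  qed
  have lm: "l c' \<le>o m c" if "c \<in> C'" "c' \<in> C'" "(c', c) \<in> k - Id" for c c'
    using that m cardSuc_least unfolding C'_def l_def by blast
  have "\<exists>D. \<forall>c\<in>C'. D c \<subseteq> K \<and> |D c| =o l c"
  proof (rule bchoice, rule ballI)
    fix c assume "c \<in> C'"
    then have "c \<in> K" using C'K by blast
    then have "l c \<le>o |K|" using lk ordLess_imp_ordLeq unfolding k_def by blast
    moreover have Fl: "|Field (l c)| =o l c" using l card_of_Field_ordIso by blast
    ultimately have "|Field (l c)| \<le>o |K|" using ordIso_ordLeq_trans by blast
    then have "\<exists>B\<subseteq>K. |Field (l c)| =o |B| \<and> |B| \<le>o |K|"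
      by (rule iffD1[OF internalize_card_of_ordLeq2])
    then obtain B where "B \<subseteq> K" "|Field (l c)| =o |B|" by (elim exE conjE)
    moreover from this(2) have "|B| =o l c"
      using Fl ordIso_symmetric ordIso_transitive by blast
    ultimately show "\<exists>B. B \<subseteq> K \<and> |B| =o l c" by blast
  qed
  then obtain D where D: "\<And>c. c \<in> C' \<Longrightarrow> D c \<subseteq> K" "\<And>c. c \<in> C' \<Longrightarrow> |D c| =o l c" by metis
  define low where "low c = {c' \<in> C'. (c', c) \<in> k - Id}" for c
  \<comment> \<open>removing \<open>X c\<close> from \<open>D c\<close> makes blocks disjoint and stops values of \<open>f\<close> from pointing forward;
    it costs at most \<open>m c < l c\<close> elements\<close>
  define X where "X c = (\<Union>c'\<in>low c. D c' \<union> (\<Union>x\<in>D c'. f x))" for c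
  have X: "|X c| \<le>o m c" if c: "c \<in> C'" for c
    unfolding X_def
  proof (rule UNION_Cinfinite_bound[OF _ _ m], safe)
    have "low c \<subseteq> C" using C'C unfolding low_def by blast
    then show "|low c| \<le>o m c" by (rule ordLeq_transitive[OF card_of_mono1 Cm])
  next
    fix c' assume c': "c' \<in> low c"
    then have c'': "c' \<in> C'" "(c', c) \<in> k - Id" unfolding low_def by auto
    have 1: "|D c'| \<le>o m c"
      by (rule ordIso_ordLeq_trans[OF D(2)[OF c''(1)] lm[OF c c'']])
    have "|f x| \<le>o m c" if "x \<in> D c'" for x
    proof -
      have "x \<in> K" using that c'' D(1) by blast
      then show ?thesis by (rule ordLeq_transitive[OF f rm])
    qed
    then have "|\<Union>x\<in>D c'. f x| \<le>o m c" by (intro UNION_Cinfinite_bound[OF 1 _ m] ballI)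
    then show "|D c' \<union> (\<Union>x\<in>D c'. f x)| \<le>o m c" by (rule Un_Cinfinite_bound[OF 1 _ m])
  qed
  have D': "|D c - X c| =o l c" if c: "c \<in> C'" for c
  proof (rule ccontr)
    assume no: "\<not> ?thesis"
    have "|D c - X c| \<le>o l c"
      by (rule ordLeq_ordIso_trans[OF card_of_mono1[OF Diff_subset] D(2)[OF c]])
    then have "|D c - X c| <o l c" using no ordLeq_iff_ordLess_or_ordIso by blast
    moreover have "|X c| <o l c" by (rule ordLeq_ordLess_trans[OF X[OF c] ml])
    ultimately have "|(D c - X c) \<union> X c| <o l c" by (rule Un_Cinfinite_bound_strict[OF _ _ l(1)])
    moreover have "|D c| \<le>o |(D c - X c) \<union> X c|" by (intro card_of_mono1) blast
    ultimately have "|D c| <o l c" using ordLeq_ordLess_trans by blast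
    then show False using D(2)[OF c] not_ordLess_ordIso by blast
  qed
  have nl: "n <o l c" for c by (rule ordLeq_ordLess_trans[OF nm ml])
  have "cardSuc r \<le>o n"
    unfolding n_def using rq r q by (simp add: cardSuc_mono_ordLeq)
  then have rl: "cardSuc r <o l c" for c by (rule ordLeq_ordLess_trans[OF _ nl])
  have "\<exists>E. \<forall>c\<in>C'. E c \<subseteq> D c - X c \<and> free_set f (E c) \<and> |E c| =o l c"
  proof (rule bchoice, rule ballI)
    fix c assume c: "c \<in> C'"
    have "x \<in> K" if "x \<in> D c - X c" for x using that D(1)[OF c] by blast
    then show "\<exists>E. E \<subseteq> D c - X c \<and> free_set f E \<and> |E| =o l c"
      by (intro free_set_regular[OF r l rl D'[OF c]] f)
  qed
  then obtain E where E: "\<And>c. c \<in> C' \<Longrightarrow> E c \<subseteq> D c - X c" "\<And>c. c \<in> C' \<Longrightarrow> free_set f (E c)"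
    "\<And>c. c \<in> C' \<Longrightarrow> |E c| =o l c" by metis
  \<comment> \<open>\<open>p = (P, b)\<close>: the pieces \<open>P i\<close> of block \<open>c\<close> of colour \<open>i\<close>, and the bound \<open>b\<close> from which on
    a colour is safe against the earlier blocks\<close>
  define Q where "Q G c p \<longleftrightarrow> snd p \<in> Field n \<and> (\<forall>i\<in>Field n. fst p i \<subseteq> E c \<and> |fst p i| =o l c) \<and>
     disjoint_family_on (fst p) (Field n) \<and>
     (\<forall>i\<in>Field n. \<forall>j\<in>Field n. (snd p, j) \<in> n \<longrightarrow> (\<forall>x\<in>fst p i. f x \<inter> G j = {}))"
    for G and c and p :: "(('a + 'r) set \<Rightarrow> 'a set) \<times> ('a + 'r) set"
  have tot: "(c, d) \<in> k - Id \<or> (d, c) \<in> k - Id" if "c \<in> C'" "d \<in> C'" "c \<noteq> d" for c d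
  proof -
    have "c \<in> Field k" "d \<in> Field k" using that C'K Fk by auto
    then have "(c, d) \<in> k \<or> (d, c) \<in> k" using wo_rel.TOTALS[OF W] by blast
    then show ?thesis using that(3) by blast
  qed
  have Edis: "E c \<inter> E c' = {}" if "c \<in> C'" "c' \<in> C'" "c \<noteq> c'" for c c'
  proof -
    have "E a \<inter> E b = {}" if "a \<in> C'" "b \<in> C'" "(a, b) \<in> k - Id" for a b
      using E(1)[OF that(1)] E(1)[OF that(2)] that unfolding X_def low_def by blast
    then show ?thesis using tot[OF that] that by blast
  qed
  have "\<exists>g. \<forall>c. c \<in> C' \<longrightarrow> Q (\<lambda>j. \<Union>c'\<in>low c. fst (g c') j) c (g c)"
  proof (rule dependent_wf_choice[OF wf_Card_order, of k
        "\<lambda>g c p. c \<in> C' \<longrightarrow> Q (\<lambda>j. \<Union>c'\<in>low c. fst (g c') j) c p"])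
    show "Card_order k" using k by blast
  next
    fix g h :: "'a \<Rightarrow> (('a + 'r) set \<Rightarrow> 'a set) \<times> ('a + 'r) set" and c p
    assume "\<And>z. (z, c) \<in> k - Id \<Longrightarrow> g z = h z"
    then have "(\<lambda>j. \<Union>c'\<in>low c. fst (g c') j) = (\<lambda>j. \<Union>c'\<in>low c. fst (h c') j)"
      unfolding low_def by auto
    then show "(c \<in> C' \<longrightarrow> Q (\<lambda>j. \<Union>c'\<in>low c. fst (g c') j) c p) \<longleftrightarrow>
        (c \<in> C' \<longrightarrow> Q (\<lambda>j. \<Union>c'\<in>low c. fst (h c') j) c p)" by simp
  next
    fix c and g :: "'a \<Rightarrow> (('a + 'r) set \<Rightarrow> 'a set) \<times> ('a + 'r) set"
    assume IH: "\<And>y. (y, c) \<in> k - Id \<Longrightarrow> y \<in> C' \<longrightarrow> Q (\<lambda>j. \<Union>c'\<in>low y. fst (g c') j) y (g y)"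
    show "\<exists>p. c \<in> C' \<longrightarrow> Q (\<lambda>j. \<Union>c'\<in>low c. fst (g c') j) c p"
    proof (cases "c \<in> C'")
      case True
      have Qy: "Q (\<lambda>j. \<Union>c'\<in>low y. fst (g c') j) y (g y)" "y \<in> C'" if "y \<in> low c" for y
        using IH that unfolding low_def by auto
      have "y = z \<and> i = j"
        if "y \<in> low c" "z \<in> low c" "i \<in> Field n" "j \<in> Field n" "x \<in> fst (g y) i" "x \<in> fst (g z) j"
        for x y z i j
      proof -
        have "x \<in> E y" "x \<in> E z" using Qy[OF that(1)] Qy[OF that(2)] that unfolding Q_def by auto
        then have "y = z" using Edis Qy(2) that(1,2) by blast
        then show ?thesis
          using Qy(1)[OF that(1)] that unfolding Q_def disjoint_family_on_def by blast
      qed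
      then have dis: "disjoint_family_on (\<lambda>j. \<Union>c'\<in>low c. fst (g c') j) (Field n)"
        unfolding disjoint_family_on_def by blast
      have EK: "x \<in> K" if "x \<in> E c" for x using that E(1)[OF True] D(1)[OF True] by blast
      have "\<exists>P b. Q (\<lambda>j. \<Union>c'\<in>low c. fst (g c') j) c (P, b)"
        using coloured_block_exists[OF n l rn nl E(3)[OF True] f[OF EK] dis]
        unfolding Q_def fst_conv snd_conv Bex_def by assumption
      then show ?thesis by (elim exE) (intro exI impI)
    qed auto
  qed
  then obtain g where g: "\<And>c. c \<in> C' \<Longrightarrow> Q (\<lambda>j. \<Union>c'\<in>low c. fst (g c') j) c (g c)" by blast
  have "|(\<lambda>c. snd (g c)) ` C'| \<le>o |C'|" by (rule card_of_image)
  then have "|(\<lambda>c. snd (g c)) ` C'| <o n"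
    by (rule ordLeq_ordLess_trans[OF ordLeq_transitive[OF _ card_of_mono1[OF C'C]] Cn])
  moreover have "(\<lambda>c. snd (g c)) ` C' \<subseteq> Field n" using g unfolding Q_def by blast
  \<comment> \<open>a colour that is safe for all blocks\<close>
  ultimately obtain b where b: "b \<in> Field n" "\<And>c. c \<in> C' \<Longrightarrow> (snd (g c), b) \<in> n"
    using regular_bounded[OF n, of "(\<lambda>c. snd (g c)) ` C'"] by (metis imageI)
  define F where "F = (\<Union>c\<in>C'. fst (g c) b)"
  have P: "fst (g c) b \<subseteq> E c" "|fst (g c) b| =o l c" if "c \<in> C'" for c
    using g[OF that] b(1) unfolding Q_def by auto
  have FK: "F \<subseteq> K" unfolding F_def using P(1) E(1) D(1) by blast
  have "free_set f F"
    unfolding free_set_def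
  proof (intro ballI impI)
    fix x y assume xy: "x \<in> F" "y \<in> F" "x \<noteq> y"
    then obtain c d where c: "c \<in> C'" "x \<in> fst (g c) b" and d: "d \<in> C'" "y \<in> fst (g d) b"
      unfolding F_def by blast
    consider "c = d" | "(c, d) \<in> k - Id" | "(d, c) \<in> k - Id"
      using tot[OF c(1) d(1)] by blast
    then show "y \<notin> f x"
    proof cases
      case 1
      then show ?thesis using E(2)[OF c(1)] P(1) c d xy(3) unfolding free_set_def by blast
    next
      case 2
      have "x \<in> D c" using P(1)[OF c(1)] E(1)[OF c(1)] c(2) by blast
      moreover have "y \<notin> X d" using P(1)[OF d(1)] E(1)[OF d(1)] d(2) by blast
      ultimately show ?thesis using 2 c(1) unfolding X_def low_def by blast
    next
      case 3
      then have "y \<in> (\<Union>c'\<in>low c. fst (g c') b)" using d unfolding low_def by blast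
      then show ?thesis using g[OF c(1)] b(1) b(2)[OF c(1)] c(2) unfolding Q_def by blast
    qed
  qed
  moreover have "|K| \<le>o |F|"
  proof -
    have lF: "l c \<le>o |F|" if "c \<in> C'" for c
    proof -
      have "|fst (g c) b| \<le>o |F|" using that unfolding F_def by (intro card_of_mono1) blast
      then show ?thesis by (rule ordIso_ordLeq_trans[OF ordIso_symmetric[OF P(2)[OF that]]])
    qed
    have mF: "m c \<le>o |F|" if c: "c \<in> C" for c
    proof -
      obtain c' where c': "c' \<in> C'" "m c \<le>o m c'" using C'[OF c] by (elim bexE)
      show ?thesis
        by (rule ordLeq_transitive[OF c'(2) ordLeq_transitive[OF ordLess_imp_ordLeq[OF ml] lF[OF c'(1)]]])
    qed
    have KC: "K \<subseteq> (\<Union>c\<in>C. underS k c)"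
      using C(2) unfolding cofinal_def Fk underS_def by blast
    then obtain c where c: "c \<in> C" using K(1) by fastforce
    have CF: "|C| \<le>o |F|" by (rule ordLeq_transitive[OF Cm mF[OF c]])
    have iF: "Cinfinite |F|"
      using cinfinite_mono[OF mF[OF c]] m[of c] card_of_Card_order[of F] by simp
    have "|\<Union>c\<in>C. underS k c| \<le>o |F|"
      by (intro UNION_Cinfinite_bound[OF CF _ iF] ballI) (rule ordLeq_transitive[OF um mF])
    then show ?thesis by (rule ordLeq_transitive[OF card_of_mono1[OF KC]])
  qed
  ultimately show ?thesis
    using FK card_of_mono1[OF FK] ordIso_iff_ordLeq by blast
qed

text \<open>
  This is Hajnal's free set theorem for set mappings whose values have size at most \<open>r\<close>. That \<open>|K|\<close> exceeds
  even the successor of \<open>r\<close> is essential: on the ordinal \<open>cardSuc r\<close>, mapping each point to the set of its predecessors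
  leaves no free set with two elements.
\<close>

lemma free_set_theorem:
  fixes f :: "'a \<Rightarrow> 'a set" and r :: "'r rel"
  assumes r: "Cinfinite r" and rK: "cardSuc r <o |K|" and f: "\<And>x. x \<in> K \<Longrightarrow> |f x| \<le>o r"
  shows "\<exists>F\<subseteq>K. free_set f F \<and> |F| =o |K|"
proof -
  have rK': "r <o |K|"
    using cardSuc_greater r rK ordLess_transitive by blast
  then have "cinfinite |K|"
    using r cinfinite_mono ordLess_imp_ordLeq by blast
  then have K: "infinite K" "Cinfinite |K|"
    using card_of_Card_order by (auto simp: cinfinite_def Field_card_of)
  show ?thesis
  proof (cases "regularCard |K|")
    case True
    then show ?thesis
      using free_set_regular[OF r K(2) _ rK card_of_refl, of f] f by blast
  next
    case False
    then show ?thesis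
      using free_set_singular[OF r K(1) _ rK', of f] f by blast
  qed
qed

section \<open>Tukey reductions to ideals that capture tails\<close>

text \<open>
  The reals that code Tukey reductions: \<open>R\<close> lists triples of a number \<open>k\<close>, a length \<open>n\<close> and (the code of) a
  subset of \<open>{..<n}\<close>, and \<open>k\<close> is put into the result as soon as an initial segment of \<open>e\<close> is listed for \<open>k\<close>.
\<close>

definition decode :: "(nat \<times> nat \<times> nat) set \<Rightarrow> nat set \<Rightarrow> nat set" where
  "decode R e = {k. \<exists>n. (k, n, set_encode (e \<inter> {..<n})) \<in> R}"

text \<open>
  A combination of the P-ideal property and non-meagerness: a P-ideal provides a set almost containing each
  \<open>X n\<close>, and non-meagerness of the ideal fills the finite defects for infinitely many \<open>n\<close>.
\<close>

definition captures_tails :: "nat set set \<Rightarrow> bool" where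
  "captures_tails E \<longleftrightarrow>
     (\<forall>X. (\<forall>n. X n \<in> E) \<longrightarrow> (\<exists>e\<in>E. infinite {n. X n - {..<n} \<subseteq> e}))"

lemma Field_relation_of_subset: "Field (relation_of (\<subseteq>) D) = D"
  by (auto simp: Field_def relation_of_def)

lemma unbounded_in_subset:
  "unbounded_in (relation_of (\<subseteq>) D) X \<longleftrightarrow> X \<subseteq> D \<and> (\<forall>b\<in>D. \<exists>x\<in>X. \<not> x \<subseteq> b)"
  unfolding unbounded_in_def Field_relation_of_subset by (auto simp: relation_of_def) blast+

lemma set_ideal_Union:
  assumes "set_ideal E" "finite S" "S \<subseteq> E"
  shows "\<Union>S \<in> E"
  using assms(2,3) by (induction S) (use assms(1) in \<open>auto simp: set_ideal_def\<close>)

text \<open>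
  If \<open>g\<close> is a Tukey map from \<open>D\<close> to \<open>E\<close>, then the sets \<open>d\<close> with \<open>g d \<subseteq> e\<close> have bounded images and hence
  are bounded themselves, so their union \<open>h e\<close> belongs to \<open>D\<close>.
\<close>

lemma tukey_le_imp_cofinal_map:
  assumes D: "set_ideal D" and le: "tukey_le (relation_of (\<subseteq>) D) (relation_of (\<subseteq>) E)"
  shows "\<exists>h. mono h \<and> (\<forall>e\<in>E. h e \<in> D) \<and> (\<forall>d\<in>D. \<exists>e\<in>E. d \<subseteq> h e)"
proof -
  obtain g where "tukey_map (relation_of (\<subseteq>) D) (relation_of (\<subseteq>) E) g"
    using le unfolding tukey_le_def by blast
  then have g: "\<And>d. d \<in> D \<Longrightarrow> g d \<in> E"
    and unb: "\<And>X. unbounded_in (relation_of (\<subseteq>) D) X \<Longrightarrow> unbounded_in (relation_of (\<subseteq>) E) (g ` X)"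
    unfolding tukey_map_def Field_relation_of_subset by auto
  define h where "h e = \<Union>{d \<in> D. g d \<subseteq> e}" for e
  have "h e \<in> D" if e: "e \<in> E" for e
  proof -
    have "\<not> unbounded_in (relation_of (\<subseteq>) E) (g ` {d \<in> D. g d \<subseteq> e})"
      using e unfolding unbounded_in_subset by blast
    then have "\<not> unbounded_in (relation_of (\<subseteq>) D) {d \<in> D. g d \<subseteq> e}" using unb by blast
    then obtain b where "b \<in> D" "\<forall>d\<in>{d \<in> D. g d \<subseteq> e}. d \<subseteq> b"
      unfolding unbounded_in_subset by blast
    then have "b \<in> D" "h e \<subseteq> b" unfolding h_def by auto
    then show ?thesis using D unfolding set_ideal_def by blast
  qed
  moreover have "mono h" unfolding h_def mono_def by blast
  moreover have "\<exists>e\<in>E. d \<subseteq> h e" if "d \<in> D" for d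
    using g that unfolding h_def by blast
  ultimately show ?thesis by blast
qed

text \<open>
  This adapts the theorem of Dobrinen and Todorcevic that Tukey reductions to p-points are continuous. Let
  \<open>h\<close> be a monotone cofinal map from \<open>E\<close> to \<open>D\<close>. Membership of \<open>k\<close> in \<open>h Z\<close> depends on the whole of \<open>Z\<close>, but
  for fixed \<open>n\<close> there are only finitely many pairs of \<open>k \<le> n\<close> and \<open>Z \<inter> {..<n}\<close>, so one \<open>X n\<close> in \<open>E\<close>
  contains a witness \<open>Z\<close> for every pair that has one. If \<open>e1\<close> contains the tail of \<open>X n\<close> beyond \<open>n\<close>, then for every \<open>Z\<close>
  in \<open>E\<close> above \<open>e1\<close> and every \<open>k \<le> n\<close> the question whether \<open>k \<in> h Z\<close> is equivalent to \<open>k \<in> h (Z \<inter> {..<n} \<union> (X n - {..<n}))\<close>, and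
  this depends on \<open>Z \<inter> {..<n}\<close> alone. Capturing tails yields an \<open>e1\<close> for which this works for arbitrarily large \<open>n\<close>,
  so on the sets above \<open>e1\<close> the map \<open>h\<close> is coded by a real. These sets are cofinal in \<open>E\<close>, hence \<open>E\<close> and
  the real determine \<open>D\<close>.
\<close>

lemma tukey_below_decoded:
  assumes E: "set_ideal E" "captures_tails E" and D: "set_ideal D"
    and le: "tukey_le (relation_of (\<subseteq>) D) (relation_of (\<subseteq>) E)"
  shows "\<exists>R. D = {A. \<exists>e\<in>E. A \<subseteq> decode R e}"
proof -
  obtain h where mono: "mono h" and hD: "\<And>e. e \<in> E \<Longrightarrow> h e \<in> D"
    and cof: "\<And>d. d \<in> D \<Longrightarrow> \<exists>e\<in>E. d \<subseteq> h e"
    using tukey_le_imp_cofinal_map[OF D le] by blast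
  have Un: "A \<union> B \<in> E" if "A \<in> E" "B \<in> E" for A B
    using E(1) that unfolding set_ideal_def by blast
  \<comment> \<open>a set \<open>Z\<close> in \<open>E\<close> with trace \<open>t\<close> on \<open>{..<n}\<close> and \<open>k \<in> h Z\<close>, where there is one; otherwise the
    default \<open>{}\<close>, which is in \<open>E\<close> as well\<close>
  define Z where "Z n t k = (if \<exists>Z\<in>E. Z \<inter> {..<n} = t \<and> k \<in> h Z
      then SOME Z. Z \<in> E \<and> Z \<inter> {..<n} = t \<and> k \<in> h Z else {})" for n t k
  have Zwit: "Z n t k \<in> E \<and> Z n t k \<inter> {..<n} = t \<and> k \<in> h (Z n t k)"
    if "Z' \<in> E" "Z' \<inter> {..<n} = t" "k \<in> h Z'" for n t k Z'
  proof -
    have "\<exists>Z. Z \<in> E \<and> Z \<inter> {..<n} = t \<and> k \<in> h Z" using that by blast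
    then show ?thesis
      using someI_ex[of "\<lambda>Z. Z \<in> E \<and> Z \<inter> {..<n} = t \<and> k \<in> h Z"] unfolding Z_def by auto
  qed
  have ZE: "Z n t k \<in> E" for n t k
  proof (cases "\<exists>Z\<in>E. Z \<inter> {..<n} = t \<and> k \<in> h Z")
    case True
    then show ?thesis using Zwit by blast
  next
    case False
    then show ?thesis using E(1) unfolding Z_def set_ideal_def by auto
  qed
  define X where "X n = \<Union>((\<lambda>(t, k). Z n t k) ` (Pow {..<n} \<times> {..n}))" for n
  have "X n \<in> E" for n
    unfolding X_def using ZE by (intro set_ideal_Union[OF E(1)]) auto
  then obtain e1 where e1: "e1 \<in> E" "infinite {n. X n - {..<n} \<subseteq> e1}"
    using E(2) unfolding captures_tails_def by blast
  define N where "N = {n. X n - {..<n} \<subseteq> e1}"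
  \<comment> \<open>\<open>e1\<close> is joined to the decoded segment, so that \<open>R\<close> can be applied to every \<open>e\<close> in \<open>E\<close> and
    then describes \<open>h (e \<union> e1)\<close>\<close>
  define R where "R = {(k, n, c). n \<in> N \<and> k \<le> n \<and>
      k \<in> h (set_decode c \<union> (e1 \<inter> {..<n}) \<union> (X n - {..<n}))}"
  have R: "decode R e = h (e \<union> e1)" if e: "e \<in> E" for e
  proof (intro equalityI subsetI)
    fix k assume "k \<in> decode R e"
    then obtain n where n: "n \<in> N"
      "k \<in> h ((e \<inter> {..<n}) \<union> (e1 \<inter> {..<n}) \<union> (X n - {..<n}))"
      unfolding decode_def R_def by (auto simp: set_encode_inverse)
    have "(e \<inter> {..<n}) \<union> (e1 \<inter> {..<n}) \<union> (X n - {..<n}) \<subseteq> e \<union> e1"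
      using n(1) unfolding N_def by blast
    then show "k \<in> h (e \<union> e1)" using n(2) mono unfolding mono_def by blast
  next
    fix k assume k: "k \<in> h (e \<union> e1)"
    obtain n where n: "n \<in> N" "k \<le> n"
      using e1(2) unfolding N_def infinite_nat_iff_unbounded_le by blast
    define t where "t = (e \<union> e1) \<inter> {..<n}"
    have Z: "Z n t k \<inter> {..<n} = t" "k \<in> h (Z n t k)"
      using Zwit[OF Un[OF e e1(1)] _ k, of n t] unfolding t_def by auto
    have "Z n t k \<subseteq> X n"
      unfolding X_def
      by (intro Union_upper image_eqI[of _ _ "(t, k)"]) (use n(2) in \<open>auto simp: t_def\<close>)
    then have "Z n t k \<subseteq> (e \<inter> {..<n}) \<union> (e1 \<inter> {..<n}) \<union> (X n - {..<n})"
      using Z(1) unfolding t_def by blast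
    then have "k \<in> h ((e \<inter> {..<n}) \<union> (e1 \<inter> {..<n}) \<union> (X n - {..<n}))"
      using Z(2) mono unfolding mono_def by blast
    then show "k \<in> decode R e"
      using n unfolding decode_def R_def by (auto simp: set_encode_inverse intro!: exI[of _ n])
  qed
  have "D = {A. \<exists>e\<in>E. A \<subseteq> decode R e}"
  proof (intro equalityI subsetI)
    fix d assume "d \<in> D"
    then obtain e where e: "e \<in> E" "d \<subseteq> h e" using cof by blast
    then have "d \<subseteq> decode R e" using R[OF e(1)] mono unfolding mono_def by blast
    then show "d \<in> {A. \<exists>e\<in>E. A \<subseteq> decode R e}" using e(1) by blast
  next
    fix d assume "d \<in> {A. \<exists>e\<in>E. A \<subseteq> decode R e}"
    then obtain e where e: "e \<in> E" "d \<subseteq> h (e \<union> e1)" using R by blast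
    then show "d \<in> D" using hD[OF Un[OF e(1) e1(1)]] D unfolding set_ideal_def by blast
  qed
  then show ?thesis by blast
qed

section \<open>Towers along subsets of the first uncountable ordinal\<close>

lemma Cinfinite_omega1: "Cinfinite omega1"
  unfolding omega1_def by (rule Cinfinite_cardSuc[OF natLeq_Cinfinite])

lemma regularCard_omega1: "regularCard omega1"
  unfolding omega1_def by (rule regularCard_cardSuc[OF natLeq_Cinfinite])

lemma wo_rel_omega1: "wo_rel omega1"
  using Cinfinite_omega1 by (simp add: card_order_on_def wo_rel_def)

lemma wf_omega1: "wf (omega1 - Id)"
  using Cinfinite_omega1 wf_Card_order by blast

lemma omega1_bounded_sequence:
  assumes "\<And>n::nat. a n \<in> Field omega1"
  shows "\<exists>b\<in>Field omega1. \<forall>n. (a n, b) \<in> omega1"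
proof -
  have "|range a| \<le>o natLeq"
    using card_of_image[of a UNIV] card_of_nat ordLeq_ordIso_trans by blast
  then have "|range a| <o omega1"
    unfolding omega1_def using cardSuc_greater[OF natLeq_Card_order] ordLeq_ordLess_trans by blast
  then show ?thesis
    using regular_bounded[OF Cinfinite_omega1 regularCard_omega1, of "range a"] assms by auto
qed

lemma omega1_underS_enumerable:
  assumes "a \<in> Field omega1" "underS omega1 a \<noteq> {}"
  shows "\<exists>e::nat \<Rightarrow> nat set. range e = underS omega1 a"
proof -
  have "|underS omega1 a| <o omega1"
    by (rule card_of_underS[OF conjunct2[OF Cinfinite_omega1] assms(1)])
  then have "|underS omega1 a| \<le>o natLeq"
    unfolding omega1_def by (rule cardSuc_ordLeq_ordLess[OF natLeq_Card_order card_of_Card_order, THEN iffD1])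
  then have "|underS omega1 a| \<le>o |UNIV :: nat set|"
    using card_of_nat ordIso_symmetric ordLeq_ordIso_trans by blast
  then show ?thesis using card_of_ordLeq2[OF assms(2)] by blast
qed

text \<open>
  A sequence of points, part of which will be left out of the next tower set. It is almost disjoint from
  every set in \<open>H\<close>, so that its complement almost contains each of them, and its gaps are long enough for the
  complement to contain \<open>{Suc (p k)..<\<phi> (Suc (p k))}\<close> for every \<open>k\<close>.
\<close>

definition gap_seq :: "nat set set \<Rightarrow> (nat \<Rightarrow> nat) \<Rightarrow> (nat \<Rightarrow> nat) \<Rightarrow> bool" where
  "gap_seq H \<phi> p \<longleftrightarrow> strict_mono p \<and> (\<forall>k. \<phi> (Suc (p k)) \<le> p (Suc k)) \<and>
     (\<forall>X\<in>H. finite {k. p k \<in> X})"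

text \<open>
  Along a chain modulo finite sets, the union of finitely many co-infinite sets is again co-infinite, so
  \<open>p n\<close> can be chosen outside \<open>e 0, \<dots>, e n\<close> and as large as desired.
\<close>

lemma gap_seq_exists:
  fixes e :: "nat \<Rightarrow> nat set"
  assumes coinf: "\<And>i. infinite (- e i)"
    and chain: "\<And>i j. finite (e i - e j) \<or> finite (e j - e i)"
  shows "\<exists>p. gap_seq (range e) \<phi> p"
proof -
  have "\<exists>j. finite ((\<Union>i\<le>n. e i) - e j)" for n :: nat
  proof (induction n)
    case 0
    then show ?case by (intro exI[of _ 0]) simp
  next
    case (Suc n)
    then obtain j where j: "finite ((\<Union>i\<le>n. e i) - e j)" by blast
    show ?case
    proof (cases "finite (e j - e (Suc n))")
      case True
      have "(\<Union>i\<le>Suc n. e i) - e (Suc n) \<subseteq> ((\<Union>i\<le>n. e i) - e j) \<union> (e j - e (Suc n))"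
        by (auto simp: le_Suc_eq)
      then show ?thesis using True j by (meson finite_UnI finite_subset)
    next
      case False
      then have "finite (e (Suc n) - e j)" using chain by blast
      moreover have "(\<Union>i\<le>Suc n. e i) - e j \<subseteq> ((\<Union>i\<le>n. e i) - e j) \<union> (e (Suc n) - e j)"
        by (auto simp: le_Suc_eq)
      ultimately show ?thesis using j by (meson finite_UnI finite_subset)
    qed
  qed
  then have inf: "infinite (- (\<Union>i\<le>n. e i))" for n :: nat
  proof -
    obtain j where "finite ((\<Union>i\<le>n. e i) - e j)" using \<open>\<And>n. \<exists>j. finite ((\<Union>i\<le>n. e i) - e j)\<close> by blast
    moreover have "- e j \<subseteq> - (\<Union>i\<le>n. e i) \<union> ((\<Union>i\<le>n. e i) - e j)" by blast
    ultimately show ?thesis using coinf[of j] by (meson finite_UnI finite_subset)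
  qed
  have "\<exists>p. \<forall>n. p n \<notin> (\<Union>i\<le>n. e i) \<and> (p n < p (Suc n) \<and> \<phi> (Suc (p n)) \<le> p (Suc n))"
  proof (rule dependent_nat_choice)
    show "\<exists>x. x \<notin> (\<Union>i\<le>0. e i)" using inf[of 0] by (metis ComplD infinite_imp_nonempty equals0I)
  next
    fix x n
    obtain y where "y \<in> - (\<Union>i\<le>Suc n. e i)" "max (Suc x) (\<phi> (Suc x)) \<le> y"
      using inf[of "Suc n"] unfolding infinite_nat_iff_unbounded_le by blast
    then show "\<exists>y. y \<notin> (\<Union>i\<le>Suc n. e i) \<and> (x < y \<and> \<phi> (Suc x) \<le> y)" by auto
  qed
  then obtain p where p: "\<And>n. p n \<notin> (\<Union>i\<le>n. e i)" "\<And>n. p n < p (Suc n)"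
    "\<And>n. \<phi> (Suc (p n)) \<le> p (Suc n)" by blast
  have "finite {k. p k \<in> e i}" for i
  proof (rule finite_subset)
    show "{k. p k \<in> e i} \<subseteq> {..<i}" using p(1) by (force simp: not_le)
  qed simp
  then show ?thesis using p unfolding gap_seq_def by (auto simp: strict_mono_Suc_iff)
qed

text \<open>
  Only every second point of the gap sequence is left out, and \<open>b\<close> decides whether the even or the odd ones.
  Two different decisions at the same \<open>H\<close> give sets whose union is everything, so that no proper ideal
  contains both.
\<close>

definition tower_step :: "nat set set \<Rightarrow> (nat \<Rightarrow> nat) \<Rightarrow> bool \<Rightarrow> nat set" where
  "tower_step H \<phi> b = - range (\<lambda>k. (SOME p. gap_seq H \<phi> p) (2 * k + of_bool b))"

text \<open>
  One tower for each \<open>S \<subseteq> \<omega>\<^sub>1\<close>: at stage \<open>a\<close> the binary decision is whether \<open>a \<in> S\<close>, and the growth function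
  \<open>\<Phi> a\<close> is treated. The choices made depend only on the previous sets of the tower, so towers for \<open>S\<close> and \<open>S'\<close>
  agree until \<open>S\<close> and \<open>S'\<close> differ.
\<close>

definition branch_tower :: "(nat set \<Rightarrow> nat \<Rightarrow> nat) \<Rightarrow> nat set set \<Rightarrow> nat set \<Rightarrow> nat set" where
  "branch_tower \<Phi> S =
     wfrec (omega1 - Id) (\<lambda>T a. tower_step (T ` underS omega1 a) (\<Phi> a) (a \<in> S))"

lemma branch_tower_unfold:
  "branch_tower \<Phi> S a = tower_step (branch_tower \<Phi> S ` underS omega1 a) (\<Phi> a) (a \<in> S)"
proof -
  have "cut (branch_tower \<Phi> S) (omega1 - Id) a ` underS omega1 a = branch_tower \<Phi> S ` underS omega1 a"
    by (intro image_cong) (auto simp: cut_def underS_def)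
  then show ?thesis
    unfolding branch_tower_def by (subst wfrec[OF wf_omega1]) simp
qed

lemma tower_step_props:
  assumes "gap_seq H \<phi> p'"
  shows "X \<in> H \<Longrightarrow> finite (X - tower_step H \<phi> b)"
    and "X \<in> H \<Longrightarrow> infinite (tower_step H \<phi> b - X)"
    and "infinite (- tower_step H \<phi> b)"
    and "infinite {n. {n..<\<phi> n} \<subseteq> tower_step H \<phi> b}"
    and "tower_step H \<phi> True \<union> tower_step H \<phi> False = UNIV"
proof -
  define p where "p = (SOME p. gap_seq H \<phi> p)"
  have "gap_seq H \<phi> p" unfolding p_def by (rule someI[of "gap_seq H \<phi>", OF assms])
  then have p: "strict_mono p" "\<And>k. \<phi> (Suc (p k)) \<le> p (Suc k)"
    "\<And>X. X \<in> H \<Longrightarrow> finite {k. p k \<in> X}" unfolding gap_seq_def by auto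
  have inj: "p i = p j \<longleftrightarrow> i = j" for i j using p(1) by (rule strict_mono_eq)
  have step: "tower_step H \<phi> b = - range (\<lambda>k. p (2 * k + of_bool b))" for b
    unfolding tower_step_def p_def ..
  show "finite (X - tower_step H \<phi> b)" if "X \<in> H"
  proof (rule finite_subset)
    show "X - tower_step H \<phi> b \<subseteq> p ` {k. p k \<in> X}" unfolding step by auto
  qed (use p(3) that in simp)
  have inf: "infinite (range (\<lambda>k. p (2 * k + of_bool b)))" for b
    by (rule range_inj_infinite) (auto simp: inj_def inj)
  then show "infinite (- tower_step H \<phi> b)" unfolding step by simp
  have odd_even: "p (2 * i + of_bool b) \<noteq> p (2 * j + of_bool (\<not> b))" for i j b
    unfolding inj by (cases b) (auto, presburger+)
  show "infinite (tower_step H \<phi> b - X)" if "X \<in> H"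
  proof
    assume "finite (tower_step H \<phi> b - X)"
    then have "finite ((tower_step H \<phi> b - X) \<union> p ` {k. p k \<in> X})" using p(3) that by simp
    moreover have "range (\<lambda>k. p (2 * k + of_bool (\<not> b))) \<subseteq> (tower_step H \<phi> b - X) \<union> p ` {k. p k \<in> X}"
    proof (rule image_subsetI)
      fix k
      have "p (2 * k + of_bool (\<not> b)) \<notin> range (\<lambda>i. p (2 * i + of_bool b))"
      proof
        assume "p (2 * k + of_bool (\<not> b)) \<in> range (\<lambda>i. p (2 * i + of_bool b))"
        then obtain i where "p (2 * k + of_bool (\<not> b)) = p (2 * i + of_bool b)" by (elim imageE)
        then show False using odd_even[where b = b and i = i and j = k] by simp
      qed
      then have "p (2 * k + of_bool (\<not> b)) \<in> tower_step H \<phi> b" unfolding step by blast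
      then show "p (2 * k + of_bool (\<not> b)) \<in> (tower_step H \<phi> b - X) \<union> p ` {k. p k \<in> X}" by blast
    qed
    ultimately show False using inf finite_subset by blast
  qed
  show "tower_step H \<phi> True \<union> tower_step H \<phi> False = UNIV"
    unfolding step using odd_even[where b = False] by auto
  have "p j \<notin> {Suc (p k)..<\<phi> (Suc (p k))}" for j k
  proof (cases "j \<le> k")
    case True
    then have "p j \<le> p k" using p(1) by (simp add: strict_mono_less_eq)
    then show ?thesis by simp
  next
    case False
    then have "p (Suc k) \<le> p j" using p(1) by (simp add: strict_mono_less_eq)
    then show ?thesis using p(2)[of k] by simp
  qed
  then have "range (\<lambda>k. Suc (p k)) \<subseteq> {n. {n..<\<phi> n} \<subseteq> tower_step H \<phi> b}"
    unfolding step by blast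
  moreover have "infinite (range (\<lambda>k. Suc (p k)))"
    by (rule range_inj_infinite) (simp add: inj_def inj)
  ultimately show "infinite {n. {n..<\<phi> n} \<subseteq> tower_step H \<phi> b}" using finite_subset by blast
qed

lemma branch_tower_gap_seq:
  assumes "a \<in> Field omega1"
  shows "\<exists>p. gap_seq (branch_tower \<Phi> S ` underS omega1 a) (\<Phi> a) p"
  using wf_omega1 assms
proof (induction a rule: wf_induct_rule)
  case (less a)
  let ?T = "branch_tower \<Phi> S"
  have F: "underS omega1 a \<subseteq> Field omega1" using underS_Field by fastforce
  have IH: "\<exists>p. gap_seq (?T ` underS omega1 b) (\<Phi> b) p" if "b \<in> underS omega1 a" for b
    using less.IH[of b] that F unfolding underS_def by blast
  have fin: "finite (?T b - ?T c)" if "b \<in> underS omega1 a" "c \<in> underS omega1 a" "(b, c) \<in> omega1" for b c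
  proof (cases "b = c")
    case False
    then have "?T b \<in> ?T ` underS omega1 c" using that(3) unfolding underS_def by blast
    then show ?thesis
      unfolding branch_tower_unfold[of _ _ c] using IH[OF that(2)] tower_step_props(1) by blast
  qed simp
  show ?case
  proof (cases "underS omega1 a = {}")
    case True
    have "\<exists>p. gap_seq (range (\<lambda>_::nat. {})) (\<Phi> a) p" by (rule gap_seq_exists) auto
    then show ?thesis unfolding True gap_seq_def by auto
  next
    case False
    then obtain e :: "nat \<Rightarrow> nat set" where e: "range e = underS omega1 a"
      using omega1_underS_enumerable[OF less.prems False] by (elim exE)
    then have e': "e i \<in> underS omega1 a" for i by blast
    have "\<exists>p. gap_seq (range (\<lambda>i. ?T (e i))) (\<Phi> a) p"
    proof (rule gap_seq_exists)
      show "infinite (- ?T (e i))" for i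
        unfolding branch_tower_unfold[of _ _ "e i"] using IH[OF e'] tower_step_props(3) by blast
      show "finite (?T (e i) - ?T (e j)) \<or> finite (?T (e j) - ?T (e i))" for i j
        using fin[OF e' e'] wo_rel.TOTALS[OF wo_rel_omega1] e' F by blast
    qed
    then show ?thesis by (simp add: e[symmetric] image_image)
  qed
qed

lemma branch_tower_props:
  fixes S :: "nat set set" and \<Phi> :: "nat set \<Rightarrow> nat \<Rightarrow> nat"
  assumes a: "a \<in> Field omega1"
  defines "T \<equiv> branch_tower \<Phi> S"
  shows "(b, a) \<in> omega1 \<Longrightarrow> finite (T b - T a)"
    and "(b, a) \<in> omega1 \<Longrightarrow> b \<noteq> a \<Longrightarrow> infinite (T a - T b)"
    and "infinite (- T a)"
    and "infinite {n. {n..<\<Phi> a n} \<subseteq> T a}"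
proof -
  obtain p where p: "gap_seq (T ` underS omega1 a) (\<Phi> a) p"
    using branch_tower_gap_seq[OF a] unfolding T_def by blast
  note props = tower_step_props[OF p]
  have Ta: "T a = tower_step (T ` underS omega1 a) (\<Phi> a) (a \<in> S)"
    unfolding T_def by (rule branch_tower_unfold)
  have mem: "T b \<in> T ` underS omega1 a" if "(b, a) \<in> omega1" "b \<noteq> a"
    using that unfolding underS_def by blast
  show "finite (T b - T a)" if "(b, a) \<in> omega1"
  proof (cases "b = a")
    case False
    show ?thesis by (subst Ta) (rule props(1)[OF mem[OF that False]])
  qed simp
  show "infinite (T a - T b)" if "(b, a) \<in> omega1" "b \<noteq> a"
    by (subst Ta) (rule props(2)[OF mem[OF that]])
  show "infinite (- T a)" "infinite {n. {n..<\<Phi> a n} \<subseteq> T a}"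
    by (subst Ta, rule props)+
qed

lemma tower_branch_tower: "tower (branch_tower \<Phi> S)"
  unfolding tower_def
proof (intro ballI iffI)
  fix a b assume ab: "a \<in> Field omega1" "b \<in> Field omega1"
  then show "(a, b) \<in> omega1 \<Longrightarrow> finite (branch_tower \<Phi> S a - branch_tower \<Phi> S b)"
    using branch_tower_props(1) by blast
  assume "finite (branch_tower \<Phi> S a - branch_tower \<Phi> S b)"
  then have "\<not> ((b, a) \<in> omega1 \<and> b \<noteq> a)" using branch_tower_props(2)[OF ab(1)] by blast
  then show "(a, b) \<in> omega1" using wo_rel.TOTALS[OF wo_rel_omega1] ab by blast
qed

lemma set_ideal_tower_ideal: "set_ideal (tower_ideal T)"
  unfolding tower_ideal_def by (rule hull_in) (auto simp: set_ideal_def)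

lemma tower_set_in_tower_ideal: "a \<in> Field omega1 \<Longrightarrow> T a \<in> tower_ideal T"
  unfolding tower_ideal_def by (auto intro: hull_inc)

lemma tower_ideal_eq:
  assumes T: "tower T"
  shows "tower_ideal T = {A. \<exists>a\<in>Field omega1. finite (A - T a)}"
proof
  let ?I = "{A. \<exists>a\<in>Field omega1. finite (A - T a)}"
  obtain a0 where a0: "a0 \<in> Field omega1"
    using Cinfinite_omega1 unfolding cinfinite_def by (metis ex_in_conv finite.emptyI)
  have "A \<union> B \<in> ?I" if AB: "A \<in> ?I" "B \<in> ?I" for A B
  proof -
    obtain a b where ab: "a \<in> Field omega1" "finite (A - T a)" "b \<in> Field omega1" "finite (B - T b)"
      using AB by blast
    have mono: "finite (C - T d)" if "finite (C - T c)" "(c, d) \<in> omega1" "c \<in> Field omega1"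
      "d \<in> Field omega1" for C c d
    proof -
      have "finite (T c - T d)" using T that unfolding tower_def by blast
      moreover have "C - T d \<subseteq> (C - T c) \<union> (T c - T d)" by blast
      ultimately show ?thesis using that(1) by (meson finite_UnI finite_subset)
    qed
    have "(a, b) \<in> omega1 \<or> (b, a) \<in> omega1"
      using wo_rel.TOTALS[OF wo_rel_omega1] ab by blast
    then have "\<exists>c\<in>Field omega1. finite (A - T c) \<and> finite (B - T c)"
      using mono ab by blast
    then show ?thesis by (auto simp: Un_Diff)
  qed
  moreover have "B \<in> ?I" if "A \<in> ?I" "B \<subseteq> A" for A B
    using that by (auto intro: finite_subset[OF Diff_mono[OF that(2) order_refl]])
  ultimately have "set_ideal ?I" using a0 unfolding set_ideal_def by auto
  moreover have "T a \<in> ?I" if "a \<in> Field omega1" for a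
    using that by (auto intro!: bexI[of _ a])
  then have "T ` Field omega1 \<union> {F. finite F} \<subseteq> ?I" using a0 by auto
  ultimately show "tower_ideal T \<subseteq> ?I"
    unfolding tower_ideal_def by (intro hull_minimal)
  show "?I \<subseteq> tower_ideal T"
  proof
    fix A assume "A \<in> ?I"
    then obtain a where a: "a \<in> Field omega1" "finite (A - T a)" by blast
    have "T a \<in> tower_ideal T" "A - T a \<in> tower_ideal T"
      unfolding tower_ideal_def using a by (auto intro: hull_inc)
    moreover have "A \<subseteq> T a \<union> (A - T a)" by blast
    ultimately show "A \<in> tower_ideal T"
      using set_ideal_tower_ideal[of T] unfolding set_ideal_def by metis
  qed
qed

text \<open>
  The regularity of \<open>\<omega>\<^sub>1\<close> yields a tower set \<open>T b\<close> that almost contains all \<open>X n\<close>. If \<open>\<phi> n\<close> bounds the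
  finite difference, then the stage that treats \<open>\<phi>\<close> contributes the interval \<open>{n..<\<phi> n}\<close>
  for infinitely many \<open>n\<close>.
\<close>

lemma branch_ideal_captures_tails:
  assumes \<Phi>: "\<And>\<phi>. \<exists>a\<in>Field omega1. \<Phi> a = \<phi>"
  shows "captures_tails (tower_ideal (branch_tower \<Phi> S))"
  unfolding captures_tails_def
proof (intro allI impI)
  fix X :: "nat \<Rightarrow> nat set"
  let ?T = "branch_tower \<Phi> S"
  note eq = tower_ideal_eq[OF tower_branch_tower]
  assume "\<forall>n. X n \<in> tower_ideal ?T"
  then obtain a where a: "\<And>n. a n \<in> Field omega1" "\<And>n. finite (X n - ?T (a n))"
    unfolding eq by (auto simp: Bex_def) metis
  obtain b where b: "b \<in> Field omega1" "\<And>n. (a n, b) \<in> omega1"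
    using omega1_bounded_sequence[of a, OF a(1)] by auto
  have "finite (X n - ?T b)" for n
  proof (rule finite_subset)
    show "X n - ?T b \<subseteq> (X n - ?T (a n)) \<union> (?T (a n) - ?T b)" by blast
  qed (use a(2) branch_tower_props(1)[OF b(1) b(2)] in simp)
  then have "\<exists>m. X n - ?T b \<subseteq> {..<m}" for n
    using finite_nat_iff_bounded by blast
  then obtain \<phi> where \<phi>: "\<And>n. X n - ?T b \<subseteq> {..<\<phi> n}" by metis
  obtain c where c: "c \<in> Field omega1" "\<Phi> c = \<phi>" using \<Phi> by blast
  have "?T b \<in> tower_ideal ?T" "?T c \<in> tower_ideal ?T"
    using b(1) c(1) tower_set_in_tower_ideal by blast+
  then have "?T b \<union> ?T c \<in> tower_ideal ?T"
    using set_ideal_tower_ideal unfolding set_ideal_def by blast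
  moreover have "infinite {n. X n - {..<n} \<subseteq> ?T b \<union> ?T c}"
  proof -
    have "X n - {..<n} \<subseteq> ?T b \<union> ?T c" if "{n..<\<phi> n} \<subseteq> ?T c" for n
      using that \<phi>[of n] by (force simp: not_less)
    then have "{n. {n..<\<phi> n} \<subseteq> ?T c} \<subseteq> {n. X n - {..<n} \<subseteq> ?T b \<union> ?T c}" by blast
    then show ?thesis using branch_tower_props(4)[OF c(1), of \<Phi> S] c(2) finite_subset by blast
  qed
  ultimately show "\<exists>e\<in>tower_ideal ?T. infinite {n. X n - {..<n} \<subseteq> e}" by blast
qed

lemma branch_tower_local:
  assumes "\<And>c. (c, a) \<in> omega1 \<Longrightarrow> c \<in> S \<longleftrightarrow> c \<in> S'" and "a \<in> Field omega1"
  shows "branch_tower \<Phi> S a = branch_tower \<Phi> S' a"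
  using wf_omega1 assms
proof (induction a rule: wf_induct_rule)
  case (less a)
  have "branch_tower \<Phi> S b = branch_tower \<Phi> S' b" if b: "b \<in> underS omega1 a" for b
  proof (rule less.IH)
    show ba: "(b, a) \<in> omega1 - Id" using b unfolding underS_def by blast
    show "b \<in> Field omega1" using ba by (auto simp: Field_def)
    show "c \<in> S \<longleftrightarrow> c \<in> S'" if "(c, b) \<in> omega1" for c
      using less.prems(1)[of c] wo_rel.TRANS[OF wo_rel_omega1] that ba unfolding trans_def by blast
  qed
  then have "branch_tower \<Phi> S ` underS omega1 a = branch_tower \<Phi> S' ` underS omega1 a"
    by (intro image_cong) auto
  moreover have "(a, a) \<in> omega1"
    using wo_rel.TOTALS[OF wo_rel_omega1] less.prems(2) by blast
  then have "a \<in> S \<longleftrightarrow> a \<in> S'" by (rule less.prems(1))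
  ultimately show ?case by (simp add: branch_tower_unfold[of _ _ a])
qed

text \<open>
  At the least stage where \<open>S\<close> and \<open>S'\<close> differ, the two tower sets cover \<open>\<omega>\<close>, and \<open>\<omega>\<close> is in neither ideal.
\<close>

lemma inj_branch_ideal:
  "inj_on (\<lambda>S. tower_ideal (branch_tower \<Phi> S)) (Pow (Field omega1))"
proof (rule inj_onI, rule ccontr)
  fix S S' assume SS: "S \<in> Pow (Field omega1)" "S' \<in> Pow (Field omega1)"
    and eq: "tower_ideal (branch_tower \<Phi> S) = tower_ideal (branch_tower \<Phi> S')" and ne: "S \<noteq> S'"
  let ?T = "branch_tower \<Phi>"
  obtain z where "z \<in> (S - S') \<union> (S' - S)" using ne by blast
  then obtain a where a: "a \<in> (S - S') \<union> (S' - S)"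
    and least: "\<And>c. (c, a) \<in> omega1 - Id \<Longrightarrow> c \<notin> (S - S') \<union> (S' - S)"
    using wfE_min[OF wf_omega1] by metis
  have aF: "a \<in> Field omega1" using a SS by blast
  have "?T S b = ?T S' b" if b: "b \<in> underS omega1 a" for b
  proof (rule branch_tower_local)
    have ba: "(b, a) \<in> omega1" "b \<noteq> a" using b unfolding underS_def by auto
    then show "b \<in> Field omega1" by (auto simp: Field_def)
    fix c assume cb: "(c, b) \<in> omega1"
    then have "(c, a) \<in> omega1" "c \<noteq> a"
      using ba wo_rel.TRANS[OF wo_rel_omega1] wo_rel.ANTISYM[OF wo_rel_omega1]
      unfolding trans_def antisym_def by blast+
    then show "c \<in> S \<longleftrightarrow> c \<in> S'" using least[of c] by blast
  qed
  then have H: "?T S' ` underS omega1 a = ?T S ` underS omega1 a"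
    by (intro image_cong) auto
  obtain p where "gap_seq (?T S ` underS omega1 a) (\<Phi> a) p"
    using branch_tower_gap_seq[OF aF] by blast
  then have "?T S a \<union> ?T S' a = UNIV"
    unfolding branch_tower_unfold[of _ _ a] H
    using tower_step_props(5) a by (cases "a \<in> S") auto
  moreover have "?T S a \<in> tower_ideal (?T S)" "?T S' a \<in> tower_ideal (?T S')"
    using aF tower_set_in_tower_ideal by blast+
  then have "?T S a \<union> ?T S' a \<in> tower_ideal (?T S)"
    using set_ideal_tower_ideal unfolding set_ideal_def eq[symmetric] by blast
  ultimately have "UNIV \<in> tower_ideal (?T S)" by simp
  then show False
    unfolding tower_ideal_eq[OF tower_branch_tower] using branch_tower_props(3)
    by (auto simp: Compl_eq_Diff_UNIV)
qed

section \<open>Incomparable tower ideals under CH\<close>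

lemma card_le_omega1_of_CH:
  fixes A :: "'a set" and j :: "'a \<Rightarrow> nat set"
  assumes "continuum =o omega1" "inj j"
  shows "|A| \<le>o omega1"
proof -
  have "inj (\<lambda>a x. x \<in> j a)"
    using assms(2) unfolding inj_def fun_eq_iff by blast
  then have "inj_on (\<lambda>a x. x \<in> j a) A" by (rule inj_on_subset) simp
  then have "\<exists>g :: 'a \<Rightarrow> nat \<Rightarrow> bool. inj_on g A \<and> g ` A \<subseteq> UNIV" by (intro exI conjI subset_UNIV)
  then have "|A| \<le>o |UNIV :: (nat \<Rightarrow> bool) set|" by (rule iffD1[OF card_of_ordLeq])
  moreover have "continuum = |UNIV :: (nat \<Rightarrow> bool) set|"
    unfolding continuum_def cexp_def ctwo_def Field_card_of Field_natLeq Func_def by simp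
  ultimately show ?thesis using assms(1) ordLeq_ordIso_trans by metis
qed

theorem theorem53:
  assumes "omega2 <o ctwo ^c omega1"
    and "continuum =o omega1"
  shows "\<exists>K :: nat set rel set set.
           K \<subseteq> tukey_classes \<and>
           |K| =o ctwo ^c continuum \<and>
           (\<forall>C\<in>K. \<exists>T. tower T \<and> relation_of (\<subseteq>) (tower_ideal T) \<in> C) \<and>
           pairwise tukey_incomparable K"
proof -
  note CH = card_le_omega1_of_CH[OF assms(2)]
  have "inj (\<lambda>\<phi>::nat \<Rightarrow> nat. range (\<lambda>n. prod_encode (n, \<phi> n)))"
  proof (rule injI, rule ext)
    fix \<phi> \<psi> :: "nat \<Rightarrow> nat" and n
    assume "range (\<lambda>n. prod_encode (n, \<phi> n)) = range (\<lambda>n. prod_encode (n, \<psi> n))"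
    then have "prod_encode (n, \<phi> n) \<in> range (\<lambda>n. prod_encode (n, \<psi> n))" by blast
    then show "\<phi> n = \<psi> n" by auto
  qed
  then have "|UNIV :: (nat \<Rightarrow> nat) set| \<le>o omega1" by (rule CH)
  then have "|UNIV :: (nat \<Rightarrow> nat) set| \<le>o |Field omega1|"
    using card_of_Field_ordIso[OF conjunct2[OF Cinfinite_omega1]] ordIso_symmetric ordLeq_ordIso_trans
    by metis
  then obtain \<Phi> :: "nat set \<Rightarrow> nat \<Rightarrow> nat" where "\<Phi> ` Field omega1 = UNIV"
    using card_of_ordLeq2[of "UNIV :: (nat \<Rightarrow> nat) set" "Field omega1"] by auto
  then have \<Phi>: "\<exists>a\<in>Field omega1. \<Phi> a = \<phi>" for \<phi> by (metis UNIV_I imageE)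
  define I where "I S = tower_ideal (branch_tower \<Phi> S)" for S
  \<comment> \<open>the \<open>2^\<omega>\<^sub>1\<close> many ideals; among them each has at most \<open>\<omega>\<^sub>1\<close> many Tukey predecessors\<close>
  define \<E> where "\<E> = I ` Pow (Field omega1)"
  have "|Pow (Field omega1)| =o |\<E>|"
    using inj_branch_ideal[of \<Phi>] card_of_ordIso unfolding \<E>_def I_def bij_betw_def by blast
  moreover have "|Pow (Field omega1)| =o ctwo ^c omega1"
    unfolding cexp_def ctwo_def Field_card_of by (rule card_of_Pow_Func)
  ultimately have \<E>: "|\<E>| =o ctwo ^c omega1"
    using ordIso_symmetric ordIso_transitive by metis
  have ideal: "set_ideal E" if "E \<in> \<E>" for E
    using that set_ideal_tower_ideal unfolding \<E>_def I_def by blast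
  have capt: "captures_tails E" if "E \<in> \<E>" for E
    using that branch_ideal_captures_tails[OF \<Phi>] unfolding \<E>_def I_def by blast
  let ?rel = "relation_of (\<subseteq>) :: nat set set \<Rightarrow> nat set rel"
  define below where "below E = {D \<in> \<E>. tukey_le (?rel D) (?rel E)}" for E
  have "|below E| \<le>o omega1" if E: "E \<in> \<E>" for E
  proof -
    let ?d = "\<lambda>R. {A. \<exists>e\<in>E. A \<subseteq> decode R e}"
    have "below E \<subseteq> range ?d"
      using tukey_below_decoded[OF ideal[OF E] capt[OF E] ideal] unfolding below_def by blast
    then have "|below E| \<le>o |UNIV :: (nat \<times> nat \<times> nat) set set|"
      using surj_imp_ordLeq by blast
    moreover have "inj (\<lambda>(a :: nat, b :: nat, c :: nat). prod_encode (a, prod_encode (b, c)))"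
      by (auto simp: inj_def)
    then have "inj (\<lambda>R. (\<lambda>(a, b, c). prod_encode (a, prod_encode (b, c))) ` R)"
      by (intro injI) (simp add: inj_image_eq_iff)
    then have "|UNIV :: (nat \<times> nat \<times> nat) set set| \<le>o omega1" by (rule CH)
    ultimately show ?thesis by (rule ordLeq_transitive)
  qed
  \<comment> \<open>the first hypothesis is exactly the gap that the free set theorem asks for\<close>
  moreover have "cardSuc omega1 <o |\<E>|"
    by (rule ordLess_ordIso_trans[OF assms(1)[unfolded omega2_def] ordIso_symmetric[OF \<E>]])
  ultimately obtain \<F> where \<F>: "\<F> \<subseteq> \<E>" "free_set below \<F>" "|\<F>| =o |\<E>|"
    using free_set_theorem[OF Cinfinite_omega1, of \<E> below] by auto
  have free: "\<not> tukey_le (?rel D) (?rel E)" if "D \<in> \<F>" "E \<in> \<F>" "D \<noteq> E" for D E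
    using that \<F>(1,2) unfolding free_set_def below_def by blast
  define cls where "cls E = tukey_equiv_rel `` {?rel E}" for E
  have tow: "\<exists>T. tower T \<and> E = tower_ideal T" if "E \<in> \<F>" for E
    using that \<F>(1) tower_branch_tower unfolding \<E>_def I_def by blast
  have dir: "directed_set (?rel E)" if "E \<in> \<F>" for E
    using tow[OF that] directed_set_tower_ideal by blast
  have mem: "?rel E \<in> cls E" and cls: "cls E \<in> tukey_classes" if E: "E \<in> \<F>" for E
  proof -
    have D: "?rel E \<in> Collect directed_set" using dir[OF E] by simp
    show "?rel E \<in> cls E"
      unfolding cls_def by (rule equiv_class_self[OF equiv_tukey_equiv_rel D])
    show "cls E \<in> tukey_classes"
      unfolding cls_def tukey_classes_def by (rule quotientI[OF D])
  qed
  have le: "tukey_class_le (cls D) (cls E) \<longleftrightarrow> tukey_le (?rel D) (?rel E)"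
    if "D \<in> \<F>" "E \<in> \<F>" for D E
    by (rule tukey_class_le_iff[OF cls cls mem mem]) (rule that)+
  have "inj_on cls \<F>"
  proof (rule inj_onI, rule ccontr)
    fix D E assume DE: "D \<in> \<F>" "E \<in> \<F>" "cls D = cls E" "D \<noteq> E"
    have "tukey_class_le (cls D) (cls D)" using le[OF DE(1,1)] tukey_le_refl by blast
    then show False using le[OF DE(1,2)] free[OF DE(1,2,4)] DE(3) by simp
  qed
  then have "|\<F>| =o |cls ` \<F>|"
    using card_of_ordIso unfolding bij_betw_def by blast
  moreover have "ctwo ^c omega1 =o ctwo ^c continuum"
    using cexp_cong2[OF ordIso_symmetric[OF assms(2)] Card_order_ctwo] Cinfinite_omega1 by blast
  ultimately have "|cls ` \<F>| =o ctwo ^c continuum"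
    using \<F>(3) \<E> ordIso_symmetric ordIso_transitive by metis
  moreover have "pairwise tukey_incomparable (cls ` \<F>)"
    unfolding pairwise_def tukey_incomparable_def using free le by auto
  moreover have "\<forall>C\<in>cls ` \<F>. \<exists>T. tower T \<and> ?rel (tower_ideal T) \<in> C"
    using tow mem by blast
  ultimately show ?thesis using cls by (intro exI[of _ "cls ` \<F>"]) blast
qed

end
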